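(* Let $T$ be a full binary tree of height $h$, and let $t = (h+1) \bmod 3$. Then $\mathrm{cdn}(T) = \dfrac{2^{h+1}-2^t}{7}$.
   Context: A claw is $K_{1,3}$. $\mathrm{cdn}(G)$ is the minimum number of vertices whose deletion from $G$ leaves a graph with no induced $K_{1,3}$. A full $k$-ary tree is a rooted tree in which every node has either zero or exactly $k$ children and all leaves have the same depth; its height is the depth of its leaves (the depth of a vertex being its distance to the root). A full binary tree is a full $2$-ary tree. *)

theory Defs
  imports Complex_Main "Graph_Theory.Kuratowski"
begin

text \<open>
  Finite simple graphs are symmetric loop-free digraphs without parallel arcs, i.e. the
  locale \<^locale>\<open>graph\<close>.
\<close>

definition claw_free :: "('a, 'b) pre_digraph \<Rightarrow> bool" where
  "claw_free G \<longleftrightarrow> \<not> (\<exists>H. induced_subgraph H G \<and> complete_bipartite_digraph 1 3 H)"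

definition cdn :: "('a, 'b) pre_digraph \<Rightarrow> nat" where
  "cdn G = (LEAST n. \<exists>S. S \<subseteq> verts G \<and> finite S \<and> card S = n \<and>
     claw_free (induce_subgraph G (verts G - S)))"

text \<open>
  The constant \<^const>\<open>tree\<close> is not usable here: it forbids directed cycles, and in a symmetric
  digraph every edge yields a directed cycle of length 2. In a simple graph, the cycles of the
  underlying undirected graph are exactly the directed cycles of length at least 3.
\<close>

definition undirected_tree :: "('a, 'b) pre_digraph \<Rightarrow> bool" where
  "undirected_tree G \<longleftrightarrow> graph G \<and> Digraph_Component.connected G \<and>
     \<not> (\<exists>p. pre_digraph.cycle G p \<and> 3 \<le> length p)"

definition rooted_tree :: "('a, 'b) pre_digraph \<Rightarrow> 'a \<Rightarrow> bool" where
  "rooted_tree G r \<longleftrightarrow> undirected_tree G \<and> r \<in> verts G"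

definition graph_dist :: "('a, 'b) pre_digraph \<Rightarrow> 'a \<Rightarrow> 'a \<Rightarrow> nat" where
  "graph_dist G u v = (LEAST n. \<exists>p. pre_digraph.awalk G u p v \<and> length p = n)"

definition depth :: "('a, 'b) pre_digraph \<Rightarrow> 'a \<Rightarrow> 'a \<Rightarrow> nat" where
  "depth G r v = graph_dist G v r"

definition children :: "('a, 'b) pre_digraph \<Rightarrow> 'a \<Rightarrow> 'a \<Rightarrow> 'a set" where
  "children G r v = {w \<in> verts G. v \<rightarrow>\<^bsub>G\<^esub> w \<and> depth G r w = depth G r v + 1}"

definition leaves :: "('a, 'b) pre_digraph \<Rightarrow> 'a \<Rightarrow> 'a set" where
  "leaves G r = {v \<in> verts G. children G r v = {}}"

definition full_kary_tree :: "nat \<Rightarrow> ('a, 'b) pre_digraph \<Rightarrow> 'a \<Rightarrow> bool" where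
  "full_kary_tree k G r \<longleftrightarrow> rooted_tree G r \<and>
     (\<forall>v \<in> verts G. card (children G r v) = 0 \<or> card (children G r v) = k) \<and>
     (\<forall>u \<in> leaves G r. \<forall>v \<in> leaves G r. depth G r u = depth G r v)"

text \<open>
  In a full \<open>k\<close>-ary tree all leaves have the same depth and, by finiteness, a leaf exists, so the
  set of leaf depths is a singleton.
\<close>

definition tree_height :: "('a, 'b) pre_digraph \<Rightarrow> 'a \<Rightarrow> nat" where
  "tree_height G r = the_elem (depth G r ` leaves G r)"

abbreviation full_binary_tree :: "('a, 'b) pre_digraph \<Rightarrow> 'a \<Rightarrow> bool" where
  "full_binary_tree \<equiv> full_kary_tree 2"

end

theory Submission
  imports Defs
begin

text \<open>
  Call a vertex critical if its height, the tree height minus its depth, is congruent to 2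
  modulo 3. Deleting the critical vertices leaves no vertex with three neighbours: a vertex of
  height 0 modulo 3 keeps at most its parent, and one of height 1 modulo 3 loses its parent.
  Conversely, the claws formed by a critical vertex, one of its children and the two children of
  that child are pairwise disjoint, so at least as many vertices have to be deleted. Level \<open>d\<close>
  has \<open>2 ^ d\<close> vertices, and the number of critical vertices is a geometric sum of ratio 8.
\<close>

section \<open>Claws in graphs\<close>

text \<open>Only the centre and its three neighbours are extracted: the upper bound refutes a claw
  by counting neighbours.\<close>

lemma (in wf_digraph) not_claw_free_induceD:
  assumes "\<not> claw_free (G \<restriction> X)"
  obtains c V where "c \<in> X" "V \<subseteq> X" "card V = 3" "\<forall>v \<in> V. c \<rightarrow> v"
proof -
  from assms obtain H where H: "induced_subgraph H (G \<restriction> X)" "complete_bipartite_digraph 1 3 H"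
    unfolding claw_free_def by blast
  then obtain U V where UV: "verts H = U \<union> V" "card U = 1" "card V = 3"
      "arcs_ends H = U \<times> V \<union> V \<times> U"
    unfolding complete_bipartite_digraph_def by blast
  obtain c where "U = {c}" using UV(2) by (rule card_1_singletonE)
  have sub: "subgraph H (G \<restriction> X)" using H(1) by (rule induced_imp_subgraph)
  then have "verts H \<subseteq> X" using subgraph_imp_subverts by fastforce
  moreover have "c \<rightarrow> v" if "v \<in> V" for v
  proof -
    have "c \<rightarrow>\<^bsub>H\<^esub> v" using UV(4) \<open>U = {c}\<close> that by auto
    then have "c \<rightarrow>\<^bsub>G \<restriction> X\<^esub> v"
      using sub by (auto simp: arcs_ends_conv subgraph_def compatible_def)
    then show ?thesis by (rule dominates_induce_subgraphD)
  qed
  ultimately show thesis using UV \<open>U = {c}\<close> by (intro that[of c V]) auto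
qed

text \<open>The subgraph induced on \<open>insert c V\<close> is itself the claw: with
  \<open>V\<close> independent and no loops, its arcs are exactly those between \<open>c\<close> and
  \<open>V\<close>.\<close>

lemma (in graph) claw_not_claw_free:
  assumes "X \<subseteq> verts G" "c \<in> X" "V \<subseteq> X" "card V = 3" "\<forall>v \<in> V. c \<rightarrow> v"
    and indep: "\<And>u v. u \<in> V \<Longrightarrow> v \<in> V \<Longrightarrow> \<not> u \<rightarrow> v"
  shows "\<not> claw_free (G \<restriction> X)"
proof -
  let ?H = "G \<restriction> insert c V"
  have HG: "induced_subgraph ?H G" using assms(1-3) by (intro induced_induce) auto
  interpret H: digraph ?H
    using HG by (intro digraph_subgraph induced_imp_subgraph)
  have sym: "symmetric ?H" using sym_arcs HG by (rule induced_graph_imp_symmetric)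
  have "c \<notin> V" using assms(5) adj_not_same by blast
  have "arcs_ends ?H = {(u, v). u \<in> insert c V \<and> v \<in> insert c V \<and> u \<rightarrow> v}"
    by (auto simp: arcs_ends_conv)
  also have "\<dots> = {c} \<times> V \<union> V \<times> {c}"
    using assms(5) indep adj_not_same by (auto intro: graph_symmetric)
  finally have ends: "arcs_ends ?H = {c} \<times> V \<union> V \<times> {c}" .
  have "complete_bipartite_digraph 1 3 ?H"
    unfolding complete_bipartite_digraph_def
  proof (intro conjI exI)
    show "graph ?H" using sym by (rule H.graphI)
    show "verts ?H = {c} \<union> V" by simp
    show "{c} \<inter> V = {}" using \<open>c \<notin> V\<close> by simp
  qed (use assms(4) ends in simp_all)
  moreover have "induced_subgraph ?H (G \<restriction> X)"
    using assms(2,3)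
    by (intro induced_subgraphI subgraphI) (auto simp: compatible_def wellformed_induce_subgraph)
  ultimately show ?thesis unfolding claw_free_def by blast
qed

section \<open>Rooted trees\<close>

locale rooted_tree_graph = graph G for G :: "('a, 'b) pre_digraph" (structure) +
  fixes r :: 'a
  assumes rooted: "rooted_tree G r"
begin

abbreviation dep :: "'a \<Rightarrow> nat" where "dep \<equiv> depth G r"

lemma root_in_verts: "r \<in> verts G"
  using rooted by (simp add: rooted_tree_def)

lemma no_cycle: "cycle p \<Longrightarrow> length p < 3"
  using rooted by (auto simp: rooted_tree_def undirected_tree_def not_le[symmetric])

lemma ex_awalk_root:
  assumes "v \<in> verts G"
  shows "\<exists>p. awalk v p r"
proof -
  \<comment> \<open>Connectedness refers to the symmetric closure, which has the same reachability
    because the arcs are already symmetric.\<close>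
  have "strongly_connected (with_proj (mk_symmetric G))"
    using rooted by (simp add: rooted_tree_def undirected_tree_def connected_def)
  then have "v \<rightarrow>\<^sup>*\<^bsub>mk_symmetric G\<^esub> r"
    using assms root_in_verts by (auto simp: strongly_connected_def)
  then show ?thesis by (simp add: reachable_mk_symmetric_eq[OF sym_arcs] reachable_awalk)
qed

lemma depth_le_length: "awalk v p r \<Longrightarrow> dep v \<le> length p"
  unfolding depth_def graph_dist_def by (rule Least_le) blast

lemma ex_shortest_awalk:
  assumes "v \<in> verts G"
  obtains p where "awalk v p r" "length p = dep v"
proof -
  have "\<exists>n p. awalk v p r \<and> length p = n" using ex_awalk_root[OF assms] by blast
  from LeastI_ex[OF this] that show thesis unfolding depth_def graph_dist_def by blast
qed

lemma depth_root: "dep r = 0"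
  using depth_le_length[of r "[]"] root_in_verts by (simp add: awalk_Nil_iff)

lemma depth_0_iff: "v \<in> verts G \<Longrightarrow> dep v = 0 \<longleftrightarrow> v = r"
  by (metis depth_root ex_shortest_awalk length_0_conv awalk_Nil_iff)

lemma depth_adj_le:
  assumes "u \<rightarrow> v"
  shows "dep u \<le> Suc (dep v)"
proof -
  obtain e where e: "e \<in> arcs G" "tail G e = u" "head G e = v" using assms by auto
  obtain p where "awalk v p r" "length p = dep v"
    using ex_shortest_awalk adj_in_verts[OF assms] by blast
  then show ?thesis using e depth_le_length[of u "e # p"] by (auto simp: awalk_Cons_iff)
qed

text \<open>The second vertex of a shortest walk to the root works: the rest of the walk bounds its
  depth above by \<open>n\<close>, and adjacency to \<open>v\<close> bounds it below.\<close>

lemma ex_parent: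
  assumes "v \<in> verts G" "dep v = Suc n"
  obtains u where "v \<rightarrow> u" "dep u = n"
proof -
  obtain p where p: "awalk v p r" "length p = Suc n" using ex_shortest_awalk assms by metis
  then obtain e q where q: "p = e # q" "length q = n" by (auto simp: length_Suc_conv)
  then have e: "e \<in> arcs G" "v = tail G e" "awalk (head G e) q r"
    using p by (auto simp: awalk_Cons_iff)
  then have "v \<rightarrow> head G e" by (auto simp: arcs_ends_conv)
  moreover have "dep (head G e) = n"
    using depth_le_length[OF e(3)] depth_adj_le[OF \<open>v \<rightarrow> head G e\<close>] q assms by simp
  ultimately show thesis by (rule that)
qed

text \<open>
  Following shortest walks to the root from two vertices of equal depth until they meet joins them
  by a path that never goes deeper. Both ways in which the depth function could fail to describe
  a tree then close such a path to a cycle.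
\<close>

lemma ex_shallow_path:
  assumes "u \<in> verts G" "v \<in> verts G" "u \<noteq> v" "dep u = n" "dep v = n"
  shows "\<exists>p. apath u p v \<and> 2 \<le> length p \<and> (\<forall>w \<in> set (awalk_verts u p). dep w \<le> n)"
  using assms
proof (induction n arbitrary: u v)
  case 0
  then show ?case by (simp add: depth_0_iff)
next
  case (Suc n)
  obtain u' where u': "u \<rightarrow> u'" "dep u' = n" using ex_parent Suc.prems by metis
  obtain v' where v': "v \<rightarrow> v'" "dep v' = n" using ex_parent Suc.prems by metis
  obtain e where e: "e \<in> arcs G" "tail G e = u" "head G e = u'" using u' by auto
  obtain f where f: "f \<in> arcs G" "tail G f = v'" "head G f = v"
    using graph_symmetric[OF v'(1)] by auto
  have verts: "u' \<in> verts G" "v' \<in> verts G" using e f by auto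
  have "\<exists>p. apath u' p v' \<and> (\<forall>w \<in> set (awalk_verts u' p). dep w \<le> n)"
  proof (cases "u' = v'")
    case True
    then show ?thesis using verts v' by (intro exI[of _ "[]"]) (auto simp: apath_Nil_iff)
  next
    case False
    then show ?thesis using Suc.IH[OF verts] u' v' by blast
  qed
  then obtain p where p: "apath u' p v'" "\<forall>w \<in> set (awalk_verts u' p). dep w \<le> n" by blast
  then have aw: "awalk u' p v'" by (simp add: apath_def)
  have pf: "awalk u' (p @ [f]) v" using aw f
    by (auto simp: awalk_append_iff awalk_Cons_iff awalk_Nil_iff)
  then have vs: "awalk_verts u' (p @ [f]) = awalk_verts u' p @ [v]"
    using f aw by (simp add: awalk_verts_append)
  \<comment> \<open>Both ends have depth \<open>Suc n\<close>, while \<open>p\<close> stays within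
    depth \<open>n\<close>; hence adding them repeats no vertex.\<close>
  have "u \<notin> set (awalk_verts u' p)" "v \<notin> set (awalk_verts u' p)"
    using p(2) Suc.prems by force+
  then have "apath u (e # p @ [f]) v"
    using p pf vs e Suc.prems by (auto simp: apath_def awalk_Cons_iff)
  moreover have "\<forall>w \<in> set (awalk_verts u (e # p @ [f])). dep w \<le> Suc n"
    using p(2) vs e Suc.prems by (auto intro: le_SucI)
  moreover have "2 \<le> length (e # p @ [f])" by simp
  ultimately show ?case by blast
qed

lemma cycle_ConsI:
  assumes "apath u p v" "e \<in> arcs G" "tail G e = v" "head G e = u"
  shows "cycle (e # p)"
  \<comment> \<open>Based at \<open>v\<close>, the closed walk visits, after its start, exactly the
    distinct vertices of \<open>p\<close>.\<close>
  unfolding cycle_def using assms by (intro exI[of _ v]) (auto simp: apath_def awalk_Cons_iff)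

text \<open>An arc between vertices of equal depth would close a shallow path of length at least 2
  to a cycle of length at least 3.\<close>

lemma adj_depth_neq:
  assumes "u \<rightarrow> v"
  shows "dep u \<noteq> dep v"
proof
  assume eq: "dep u = dep v"
  have "u \<noteq> v" using assms adj_not_same by blast
  then obtain p where p: "apath u p v" "2 \<le> length p"
    using ex_shallow_path[of u v] eq adj_in_verts[OF assms] by blast
  obtain e where "e \<in> arcs G" "tail G e = v" "head G e = u"
    using graph_symmetric[OF assms] by auto
  then show False using no_cycle[OF cycle_ConsI] p by fastforce
qed

lemma adj_depth_cases:
  assumes "u \<rightarrow> v"
  obtains "dep v = Suc (dep u)" | "dep u = Suc (dep v)"
  using depth_adj_le[OF assms] depth_adj_le[OF graph_symmetric[OF assms]] adj_depth_neq[OF assms]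
  by linarith

text \<open>A shallow path between two distinct parents avoids the deeper \<open>w\<close>, so going
  back through \<open>w\<close> closes it to a cycle of length at least 4.\<close>

lemma parent_unique:
  assumes "w \<rightarrow> u" "w \<rightarrow> v" "dep w = Suc (dep u)" "dep w = Suc (dep v)"
  shows "u = v"
proof (rule ccontr)
  assume "u \<noteq> v"
  then obtain p where p: "apath u p v" "2 \<le> length p" "\<forall>x \<in> set (awalk_verts u p). dep x \<le> dep u"
    using ex_shallow_path[of u v] assms adj_in_verts by (metis Suc_inject)
  obtain e where e: "e \<in> arcs G" "tail G e = w" "head G e = u" using assms by auto
  obtain f where f: "f \<in> arcs G" "tail G f = v" "head G f = w"
    using graph_symmetric[OF assms(2)] by auto
  have "apath w (e # p) v" using p e assms(3) by (force simp: apath_Cons_iff)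
  from no_cycle[OF cycle_ConsI[OF this f]] p show False by simp
qed

lemma in_children_iff: "w \<in> children G r v \<longleftrightarrow> v \<rightarrow> w \<and> dep w = Suc (dep v)"
  by (auto simp: children_def adj_in_verts)

lemma finite_children: "finite (children G r v)"
  by (auto simp: children_def)

lemma parent_of_child_unique:
  assumes "w \<in> children G r u" "w \<in> children G r v"
  shows "u = v"
  using assms by (auto simp: in_children_iff intro: parent_unique graph_symmetric)

lemma ex_child_of_parent:
  assumes "v \<in> verts G" "dep v = Suc n"
  obtains u where "u \<in> verts G" "dep u = n" "v \<in> children G r u"
  using ex_parent[OF assms] assms(2) by (metis in_children_iff graph_symmetric adj_in_verts(1))

end

section \<open>Full binary trees\<close>

locale full_binary_tree_graph = rooted_tree_graph +
  fixes h :: nat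
  assumes full: "full_binary_tree G r" and height: "tree_height G r = h"
begin

text \<open>A vertex of maximal depth has no children, so it is a leaf. All leaves share its depth,
  which makes the value of \<open>the_elem\<close> in \<open>tree_height\<close> the maximal
  depth.\<close>

lemma leaf_depth_and_depth_le:
  shows leaf_depth: "v \<in> leaves G r \<Longrightarrow> dep v = h"
    and depth_le_height: "v \<in> verts G \<Longrightarrow> dep v \<le> h"
proof -
  have fin: "finite (dep ` verts G)" and ne: "dep ` verts G \<noteq> {}"
    using root_in_verts by auto
  obtain m where m: "m \<in> verts G" "dep m = Max (dep ` verts G)"
    using Max_in[OF fin ne] by auto
  then have max: "dep v \<le> dep m" if "v \<in> verts G" for v
    using fin that by simp
  have leaf: "m \<in> leaves G r"
    using m(1) max by (fastforce simp: leaves_def children_def)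
  then have "dep ` leaves G r = {dep m}"
    using full unfolding full_kary_tree_def by blast
  then have "dep m = h" using height by (simp add: tree_height_def)
  then show "v \<in> leaves G r \<Longrightarrow> dep v = h" "v \<in> verts G \<Longrightarrow> dep v \<le> h"
    using \<open>dep ` leaves G r = {dep m}\<close> max by auto
qed

lemma card_children:
  assumes "v \<in> verts G" "dep v < h"
  shows "card (children G r v) = 2"
proof -
  have "v \<notin> leaves G r" using leaf_depth assms(2) by blast
  then have "children G r v \<noteq> {}" using assms(1) by (auto simp: leaves_def)
  then have "card (children G r v) \<noteq> 0" using finite_children by simp
  then show ?thesis using full assms(1) by (auto simp: full_kary_tree_def)
qed

lemma card_children_le: "v \<in> verts G \<Longrightarrow> card (children G r v) \<le> 2"
  using full by (auto simp: full_kary_tree_def)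

section \<open>Level sizes and the number of critical vertices\<close>

definition level :: "nat \<Rightarrow> 'a set" where
  "level d = {v \<in> verts G. dep v = d}"

text \<open>Each level is the disjoint union of the child sets of the level above, by existence and
  uniqueness of parents.\<close>

lemma card_level: "d \<le> h \<Longrightarrow> card (level d) = 2 ^ d"
proof (induction d)
  case 0
  have "level 0 = {r}" using depth_0_iff root_in_verts by (auto simp: level_def)
  then show ?case by simp
next
  case (Suc d)
  have "level (Suc d) = (\<Union>v \<in> level d. children G r v)"
  proof
    show "level (Suc d) \<subseteq> (\<Union>v \<in> level d. children G r v)"
    proof
      fix v assume "v \<in> level (Suc d)"
      then have "v \<in> verts G" "dep v = Suc d" by (simp_all add: level_def)
      then obtain u where "u \<in> verts G" "dep u = d" "v \<in> children G r u"
        by (rule ex_child_of_parent)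
      then show "v \<in> (\<Union>v \<in> level d. children G r v)" by (auto simp: level_def)
    qed
  qed (auto simp: level_def children_def)
  also have "card \<dots> = (\<Sum>v \<in> level d. card (children G r v))"
    by (rule card_UN_disjoint)
       (auto simp: level_def finite_children dest: parent_of_child_unique)
  also have "\<dots> = (\<Sum>v \<in> level d. 2)"
    using Suc.prems by (intro sum.cong) (auto simp: level_def card_children)
  finally show ?case using Suc by simp
qed

text \<open>
  For \<open>m < h\<close> the set \<open>critical m\<close> consists of the critical vertices of the truncation of the
  tree to depth \<open>m\<close>; this allows induction on the height.
\<close>

definition critical :: "nat \<Rightarrow> 'a set" where
  "critical m = {v \<in> verts G. (\<exists>k. m = dep v + 3 * k + 2)}"

lemma finite_critical: "finite (critical m)"
  by (simp add: critical_def)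

text \<open>Passing from \<open>k\<close> to \<open>k + 3\<close> adds \<open>2 ^ (k + 1)\<close>
  critical vertices, and 7 times this is \<open>2 ^ (k + 4) - 2 ^ (k + 1)\<close>, while the residue
  is unchanged. For \<open>m < 3\<close> at most the root is critical. The additive form avoids
  truncated subtraction.\<close>

lemma card_critical: "m \<le> h \<Longrightarrow> 7 * card (critical m) + 2 ^ ((m + 1) mod 3) = 2 ^ (m + 1)"
proof (induction m rule: less_induct)
  case (less m)
  consider "m = 0" | "m = 1" | "m = 2" | k where "m = k + 3"
    using le_Suc_ex[of 3 m] by (fastforce simp: add.commute)
  then show ?case
  proof cases
    case 3
    then have "critical m = level 0" by (auto simp: critical_def level_def)
    then show ?thesis using 3 less.prems card_level[of 0] by simp
  next
    case 4
    \<comment> \<open>With \<open>m = k + 3\<close>, the multiplier 0 gives depth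
      \<open>k + 1\<close>; a positive multiplier lowered by one gives membership in
      \<open>critical k\<close>.\<close>
    have "critical m = critical k \<union> level (k + 1)"
    proof (intro set_eqI iffI)
      fix v assume "v \<in> critical m"
      then obtain j where "v \<in> verts G" "k + 3 = dep v + 3 * j + 2"
        using 4 by (auto simp: critical_def)
      then show "v \<in> critical k \<union> level (k + 1)"
        by (cases j) (auto simp: critical_def level_def)
    next
      fix v assume "v \<in> critical k \<union> level (k + 1)"
      then show "v \<in> critical m"
      proof
        assume "v \<in> critical k"
        then obtain j where "v \<in> verts G" "k = dep v + 3 * j + 2" by (auto simp: critical_def)
        then show ?thesis using 4 by (auto simp: critical_def intro: exI[of _ "Suc j"])
      next
        assume "v \<in> level (k + 1)"
        then show ?thesis using 4 by (auto simp: critical_def level_def intro: exI[of _ 0])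
      qed
    qed
    moreover have "critical k \<inter> level (k + 1) = {}" by (auto simp: critical_def level_def)
    ultimately have "card (critical m) = card (critical k) + card (level (k + 1))"
      by (simp add: card_Un_disjoint finite_critical level_def)
    also have "card (level (k + 1)) = 2 ^ (k + 1)" using 4 less.prems by (intro card_level) simp
    finally have "card (critical m) = card (critical k) + 2 ^ (k + 1)" .
    moreover have "7 * card (critical k) + 2 ^ ((k + 1) mod 3) = 2 ^ (k + 1)"
      using less.IH[of k] 4 less.prems by simp
    moreover have "(m + 1) mod 3 = (k + 1) mod 3" using 4 by presburger
    ultimately show ?thesis using 4 by (simp add: power_add)
  qed (auto simp: critical_def)
qed

section \<open>Upper bound: deleting the critical vertices\<close>

lemma claw_free_minus_critical: "claw_free (G \<restriction> (verts G - critical h))"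
proof (rule ccontr)
  assume "\<not> claw_free (G \<restriction> (verts G - critical h))"
  then obtain c V where cV: "c \<in> verts G - critical h" "V \<subseteq> verts G - critical h" "card V = 3"
      "\<forall>v \<in> V. c \<rightarrow> v"
    by (rule not_claw_free_induceD)
  define P where "P = {v \<in> verts G. c \<rightarrow> v \<and> dep c = Suc (dep v)}"
  have P_eq: "v = w" if "v \<in> P" "w \<in> P" for v w
    using that parent_unique by (auto simp: P_def)
  then have card_P: "card P \<le> 1"
    by (simp add: card_le_Suc0_iff_eq P_def)
  have V_sub: "V \<subseteq> P \<union> children G r c"
  proof
    fix v assume "v \<in> V"
    then have "c \<rightarrow> v" "v \<in> verts G" using cV(2,4) by auto
    then show "v \<in> P \<union> children G r c"
      by (auto simp: P_def in_children_iff intro: adj_depth_cases[of c v])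
  qed
  have "dep c \<le> h" using cV(1) depth_le_height by blast
  \<comment> \<open>\<open>n\<close> is the height of \<open>c\<close>; the cases below are its
    residues modulo 3.\<close>
  then obtain n where "h = dep c + n" using le_Suc_ex by blast
  moreover obtain k where "n = 3 * k \<or> n = 3 * k + 1 \<or> n = 3 * k + 2"
  proof
    show "n = 3 * (n div 3) \<or> n = 3 * (n div 3) + 1 \<or> n = 3 * (n div 3) + 2" by linarith
  qed
  ultimately consider "h = dep c + 3 * k" | "h = dep c + 3 * k + 1" | "h = dep c + 3 * k + 2"
    by fastforce
  then show False
  proof cases
    case 1
    have "v \<notin> V" if v: "v \<in> children G r c" for v
    proof -
      have dv: "v \<in> verts G" "dep v = Suc (dep c)" using v by (auto simp: children_def)
      \<comment> \<open>A child exists, so \<open>c\<close> has positive height and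
        \<open>k > 0\<close>; the child then has height \<open>3 * (k - 1) + 2\<close>.\<close>
      then obtain j where "k = Suc j" using 1 depth_le_height[of v] by (cases k) auto
      then have "h = dep v + 3 * j + 2" using 1 dv by simp
      then have "v \<in> critical h" using dv by (auto simp: critical_def)
      then show ?thesis using cV(2) by blast
    qed
    then have "V \<subseteq> P" using V_sub by blast
    then have "card V \<le> card P" by (intro card_mono) (auto simp: P_def)
    then show False using card_P cV(3) by simp
  next
    case 2
    have "v \<notin> V" if v: "v \<in> P" for v
    proof -
      have "h = dep v + 3 * k + 2" using 2 v by (simp add: P_def)
      then have "v \<in> critical h" using v by (auto simp: critical_def P_def)
      then show ?thesis using cV(2) by blast
    qed
    then have "V \<subseteq> children G r c" using V_sub by blast
    then have "card V \<le> card (children G r c)" by (intro card_mono finite_children)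
    then show False using card_children_le[of c] cV by simp
  next
    case 3
    then show False using cV(1) by (auto simp: critical_def)
  qed
qed

section \<open>Lower bound: disjoint claws\<close>

lemma card_critical_le:
  assumes "S \<subseteq> verts G" "claw_free (G \<restriction> (verts G - S))"
  shows "card (critical h) \<le> card S"
proof -
  \<comment> \<open>Critical vertices have height at least 2, so both they and their children have
    two children.\<close>
  have crit: "v \<in> verts G" "dep v + 2 \<le> h" if "v \<in> critical h" for v
    using that by (auto simp: critical_def)
  have "\<exists>c. c \<in> children G r v" if "v \<in> critical h" for v
  proof -
    have "card (children G r v) = 2" using crit[OF that] by (intro card_children) auto
    then have "children G r v \<noteq> {}" by force
    then show ?thesis by blast
  qed
  then obtain c where c: "\<And>v. v \<in> critical h \<Longrightarrow> c v \<in> children G r v" by metis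
  \<comment> \<open>\<open>C v\<close> is the vertex set of a claw centred at the chosen child
    \<open>c v\<close>. A deletion set missing it would leave this claw intact.\<close>
  define C where "C v = insert (c v) (insert v (children G r (c v)))" for v
  have "\<exists>x. x \<in> S \<inter> C v" if v: "v \<in> critical h" for v
  proof (rule ccontr)
    assume "\<nexists>x. x \<in> S \<inter> C v"
    then have disj: "S \<inter> C v = {}" by blast
    let ?V = "insert v (children G r (c v))"
    have cv: "v \<rightarrow> c v" "dep (c v) = Suc (dep v)" "c v \<in> verts G"
      using c[OF v] by (auto simp: children_def)
    have dep_V: "dep w = dep v \<or> dep w = dep v + 2" if "w \<in> ?V" for w
      using that cv(2) by (auto simp: children_def)
    have "v \<notin> children G r (c v)" using cv(2) by (auto simp: children_def)
    then have "card ?V = 3"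
      using card_children[OF cv(3)] cv(2) crit[OF v] finite_children by simp
    moreover have "\<forall>w \<in> ?V. c v \<rightarrow> w"
      using graph_symmetric[OF cv(1)] by (auto simp: children_def)
    \<comment> \<open>The three outer vertices have depths differing by 0 or 2, whereas adjacent
      vertices differ in depth by exactly 1.\<close>
    moreover have "\<not> u \<rightarrow> w" if "u \<in> ?V" "w \<in> ?V" for u w
      using dep_V[OF that(1)] dep_V[OF that(2)] by (auto elim!: adj_depth_cases)
    moreover have "c v \<in> verts G - S" "?V \<subseteq> verts G - S"
      using disj cv(3) crit[OF v] by (auto simp: C_def children_def)
    ultimately show False
      using assms(2) claw_not_claw_free[of "verts G - S" "c v" ?V] by blast
  qed
  then obtain s where s: "\<And>v. v \<in> critical h \<Longrightarrow> s v \<in> S \<inter> C v" by metis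
  have C_disj: "v = w" if vw: "v \<in> critical h" "w \<in> critical h" and x: "x \<in> C v" "x \<in> C w" for v w x
  proof -
    have dep_C: "(x = u \<and> dep x = dep u) \<or> (x = c u \<and> dep x = dep u + 1) \<or>
        (x \<in> children G r (c u) \<and> dep x = dep u + 2)" if "u \<in> critical h" "x \<in> C u" for u
      using that c[of u] by (auto simp: C_def in_children_iff)
    have "dep v = dep w"
    proof -
      \<comment> \<open>A common vertex forces the depths of \<open>v\<close> and \<open>w\<close>
        to differ by at most 2; being congruent modulo 3, they are equal.\<close>
      have "dep v \<le> dep x" "dep x \<le> dep v + 2" "dep w \<le> dep x" "dep x \<le> dep w + 2"
        using dep_C[OF vw(1) x(1)] dep_C[OF vw(2) x(2)] by auto
      moreover obtain i j where "h = dep v + 3 * i + 2" "h = dep w + 3 * j + 2"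
        using vw unfolding critical_def by blast
      ultimately have "i = j" "dep v + 3 * i = dep w + 3 * j" by linarith+
      then show ?thesis by simp
    qed
    \<comment> \<open>Equal depths give \<open>x\<close> the same role in both claws, and uniqueness
      of parents, applied once or twice, leads back to \<open>v = w\<close>.\<close>
    then consider "v = x" "w = x" | "c v = x" "c w = x"
      | "x \<in> children G r (c v)" "x \<in> children G r (c w)"
      using dep_C[OF vw(1) x(1)] dep_C[OF vw(2) x(2)] by fastforce
    then show ?thesis
      using c[OF vw(1)] c[OF vw(2)] by cases (metis parent_of_child_unique)+
  qed
  \<comment> \<open>Disjoint claws are hit in different vertices of \<open>S\<close>.\<close>
  have "inj_on s (critical h)" using s C_disj by (metis inj_onI IntD2)
  moreover have "s ` critical h \<subseteq> S" using s by blast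
  moreover have "finite S" using assms(1) finite_verts by (rule finite_subset)
  ultimately show ?thesis by (rule card_inj_on_le)
qed

lemma cdn_eq_card_critical: "cdn G = card (critical h)"
  unfolding cdn_def
proof (rule Least_equality)
  show "\<exists>S \<subseteq> verts G. finite S \<and> card S = card (critical h) \<and> claw_free (G \<restriction> (verts G - S))"
    using claw_free_minus_critical finite_critical
    by (intro exI[of _ "critical h"]) (auto simp: critical_def)
qed (use card_critical_le in blast)

end

theorem theorem8:
  fixes T :: "('a, 'b) pre_digraph" and r :: 'a and h t :: nat
  assumes "full_binary_tree T r"
    and "tree_height T r = h"
    and "t = (h + 1) mod 3"
  shows "real (cdn T) = (2 ^ (h + 1) - 2 ^ t) / 7"
proof -
  have rooted: "rooted_tree T r" using assms(1) by (simp add: full_kary_tree_def)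
  then interpret graph T by (simp add: rooted_tree_def undirected_tree_def)
  interpret full_binary_tree_graph T r h
    using rooted assms by unfold_locales
  have "7 * cdn T + 2 ^ t = 2 ^ (h + 1)"
    using card_critical[of h] assms(3) by (simp add: cdn_eq_card_critical)
  \<comment> \<open>The identity is cast while still additive, so that the subtraction takes place
    in the reals.\<close>
  then have "real (7 * cdn T + 2 ^ t) = real (2 ^ (h + 1))" by (simp only:)
  then show ?thesis by simp
qed

end
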